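(* Let $\sigma=\{\sigma_i \mid i\in I\}$ be a partition of the set of all primes, let $G$ be a finite group and let $A$ be a $\sigma$-nilpotent subgroup of $G$. Then $A$ is $\sigma$-permutable in $G$ if and only if each characteristic subgroup of $A$ is $\sigma$-permutable in $G$.
   Context: All groups are finite. $\sigma=\{\sigma_i\mid i\in I\}$ is a partition of the set $\mathbb{P}$ of all primes into pairwise disjoint sets. $\pi(G)$ denotes the set of primes dividing $|G|$. A set $\mathcal{H}$ of subgroups of $G$ is a complete Hall $\sigma$-set of $G$ if every member $\neq 1$ of $\mathcal{H}$ is a Hall $\sigma_i$-subgroup of $G$ for some $i$, and $\mathcal{H}$ contains exactly one Hall $\sigma_i$-subgroup of $G$ for every $i$ with $\sigma_i\cap\pi(G)\neq\emptyset$. $G$ is $\sigma$-full if it possesses a complete Hall $\sigma$-set. A subgroup $A$ of $G$ is $\sigma$-permutable in $G$ if $G$ is $\sigma$-full and $AH=HA$ for every Hall $\sigma_i$-subgroup $H$ of $G$ and every $i\in I$. A group $A$ is $\sigma$-nilpotent if $A=A_1\times\cdots\times A_t$ where $\{A_1,\dots,A_t\}$ is a complete Hall $\sigma$-set of $A$. *)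

theory Defs
  imports
    "HOL-Algebra.Generated_Groups"
    "HOL-Computational_Algebra.Primes"
    "HOL-Library.Disjoint_Sets"
begin

definition prime_partition :: "('i \<Rightarrow> nat set) \<Rightarrow> 'i set \<Rightarrow> bool" where
  "prime_partition \<sigma> I \<longleftrightarrow>
     disjoint_family_on \<sigma> I \<and> (\<Union>i\<in>I. \<sigma> i) = {p::nat. prime p}"

definition prime_divisors_of :: "nat \<Rightarrow> nat set" where
  "prime_divisors_of n = {p. prime p \<and> p dvd n}"

definition hall_subgroup :: "nat set \<Rightarrow> ('a, 'b) monoid_scheme \<Rightarrow> 'a set \<Rightarrow> bool" where
  "hall_subgroup \<pi> G H \<longleftrightarrow>
     subgroup H G \<and>
     prime_divisors_of (card H) \<subseteq> \<pi> \<and>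
     prime_divisors_of (card (rcosets\<^bsub>G\<^esub> H)) \<inter> \<pi> = {}"

text \<open>The trivial subgroup may or may not belong to \<open>\<H>\<close>.\<close>

definition complete_hall_set ::
    "('i \<Rightarrow> nat set) \<Rightarrow> 'i set \<Rightarrow> ('a, 'b) monoid_scheme \<Rightarrow> 'a set set \<Rightarrow> bool" where
  "complete_hall_set \<sigma> I G \<H> \<longleftrightarrow>
     (\<forall>H\<in>\<H>. subgroup H G) \<and>
     (\<forall>H\<in>\<H>. H \<noteq> {\<one>\<^bsub>G\<^esub>} \<longrightarrow> (\<exists>i\<in>I. hall_subgroup (\<sigma> i) G H)) \<and>
     (\<forall>i\<in>I. \<sigma> i \<inter> prime_divisors_of (order G) \<noteq> {} \<longrightarrow>
        (\<exists>!H. H \<in> \<H> \<and> hall_subgroup (\<sigma> i) G H))"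

definition sigma_full ::
    "('i \<Rightarrow> nat set) \<Rightarrow> 'i set \<Rightarrow> ('a, 'b) monoid_scheme \<Rightarrow> bool" where
  "sigma_full \<sigma> I G \<longleftrightarrow> (\<exists>\<H>. complete_hall_set \<sigma> I G \<H>)"

definition sigma_permutable ::
    "('i \<Rightarrow> nat set) \<Rightarrow> 'i set \<Rightarrow> ('a, 'b) monoid_scheme \<Rightarrow> 'a set \<Rightarrow> bool" where
  "sigma_permutable \<sigma> I G A \<longleftrightarrow>
     subgroup A G \<and> sigma_full \<sigma> I G \<and>
     (\<forall>i\<in>I. \<forall>H. hall_subgroup (\<sigma> i) G H \<longrightarrow> A <#>\<^bsub>G\<^esub> H = H <#>\<^bsub>G\<^esub> A)"

text \<open>Internal direct decomposition: \<open>G\<close> is the direct product of the members of \<open>\<H>\<close>.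
  For empty \<open>\<H>\<close> this says that \<open>G\<close> is trivial.\<close>

definition internal_direct_product :: "('a, 'b) monoid_scheme \<Rightarrow> 'a set set \<Rightarrow> bool" where
  "internal_direct_product G \<H> \<longleftrightarrow>
     (\<forall>H\<in>\<H>. H \<lhd> G) \<and>
     generate G (\<Union>\<H>) = carrier G \<and>
     (\<forall>H\<in>\<H>. H \<inter> generate G (\<Union>(\<H> - {H})) = {\<one>\<^bsub>G\<^esub>})"

definition sigma_nilpotent ::
    "('i \<Rightarrow> nat set) \<Rightarrow> 'i set \<Rightarrow> ('a, 'b) monoid_scheme \<Rightarrow> bool" where
  "sigma_nilpotent \<sigma> I G \<longleftrightarrow>
     (\<exists>\<H>. complete_hall_set \<sigma> I G \<H> \<and> internal_direct_product G \<H>)"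

definition characteristic_subgroup :: "'a set \<Rightarrow> ('a, 'b) monoid_scheme \<Rightarrow> bool" where
  "characteristic_subgroup K G \<longleftrightarrow> subgroup K G \<and> (\<forall>\<phi>\<in>iso G G. \<phi> ` K = K)"

end

theory Submission
  imports Defs "HOL-Algebra.Elementary_Groups" "HOL-Algebra.Zassenhaus"
begin

text \<open>
  Let \<open>A\<close> be \<open>\<sigma>\<close>-nilpotent and \<open>\<sigma>\<close>-permutable in \<open>G\<close>, and let \<open>H\<close> be a Hall \<open>\<sigma> i\<close>-subgroup of
  \<open>G\<close>. Write \<open>A = P \<times> C\<close>, where \<open>P\<close> is the Hall \<open>\<sigma> i\<close>-subgroup of \<open>A\<close> and \<open>C\<close> is the product of
  the Hall subgroups of \<open>A\<close> that belong to the other classes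
  (\<open>sigma_nilpotent_splits\<close>). The factor \<open>P\<close> lies inside \<open>H\<close>, and \<open>H\<close> normalizes \<open>C\<close>. This is
  enough: for \<open>h\<close> in \<open>H\<close> the map that fixes \<open>P\<close> pointwise and conjugates \<open>C\<close> by \<open>h\<close> is an
  automorphism of \<open>A\<close>, so a characteristic subgroup \<open>K\<close> of \<open>A\<close> is invariant under it. On \<open>A\<close> this
  map differs from conjugation by \<open>h\<close> only by factors in \<open>P \<subseteq> H\<close>, whence \<open>H K \<subseteq> K H\<close>
  (\<open>characteristic_subgroup_permutes\<close>).

  Both facts about \<open>H\<close> are obtained by counting in the subgroup \<open>A H\<close>. Since the index of \<open>H\<close> in
  \<open>A H\<close> equals the index of \<open>A \<inter> H\<close> in \<open>A\<close> and divides the index of \<open>H\<close> in \<open>G\<close>, the intersection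
  \<open>A \<inter> H\<close> is a Hall \<open>\<sigma> i\<close>-subgroup of \<open>A\<close>. A Hall subgroup absorbs every normal subgroup whose
  order involves only its primes, so \<open>P \<subseteq> A \<inter> H\<close>
  (\<open>normal_subgroup_le_permuting_hall\<close>).

  For \<open>C\<close>, take a Hall \<open>\<sigma> j\<close>-subgroup \<open>Q\<close> of \<open>A\<close> with \<open>j \<noteq> i\<close>. By the first fact, applied to \<open>j\<close>,
  it lies in every Hall \<open>\<sigma> j\<close>-subgroup of \<open>G\<close>, hence in their intersection, which is normal in \<open>G\<close>.
  This intersection meets \<open>A H\<close> in a normal \<open>\<sigma> j\<close>-subgroup of \<open>A H\<close>, and the order of \<open>A H\<close> leaves
  room for no \<open>\<sigma> j\<close>-subgroup larger than \<open>Q\<close>; so the two coincide and \<open>H\<close> normalizes \<open>Q\<close>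
  (\<open>hall_normalizes_normal_hall\<close>).

  In the other direction, \<open>A\<close> is a characteristic subgroup of itself.
\<close>

section \<open>Sets of primes and orders\<close>

lemma coprime_if_disjoint_prime_divisors:
  assumes "prime_divisors_of m \<inter> prime_divisors_of n = {}"
  shows "coprime m n"
proof (rule ccontr)
  assume "\<not> coprime m n"
  then obtain p where "prime p" "p dvd gcd m n"
    using prime_factor_nat[of "gcd m n"] by (auto simp: coprime_iff_gcd_eq_1)
  then show False
    using assms by (auto simp: prime_divisors_of_def)
qed

lemma prime_divisors_of_mono: "m dvd n \<Longrightarrow> prime_divisors_of m \<subseteq> prime_divisors_of n"
  by (auto simp: prime_divisors_of_def intro: dvd_trans)

lemma prime_divisors_of_eq_empty_iff: "prime_divisors_of n = {} \<longleftrightarrow> n = 1"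
  using prime_factor_nat[of n] by (auto simp: prime_divisors_of_def)

section \<open>Products of two subgroups\<close>

context group
begin

text \<open>Each fibre of the multiplication map from \<open>A \<times> H\<close> onto the product set is a torsor under
  \<open>A \<inter> H\<close>, where \<open>d\<close> sends \<open>(a, h)\<close> to \<open>(a \<otimes> d, inv d \<otimes> h)\<close>.\<close>

lemma card_set_mult_times_card_Int:
  assumes A: "subgroup A G" and H: "subgroup H G" and fin: "finite (carrier G)"
  shows "card (A <#> H) * card (A \<inter> H) = card A * card H"
proof -
  interpret A: subgroup A G by (rule A)
  interpret H: subgroup H G by (rule H)
  have finA: "finite A" and finH: "finite H"
    using fin A.subset H.subset finite_subset by auto
  have fibre: "card {u \<in> A \<times> H. fst u \<otimes> snd u = x} = card (A \<inter> H)" if xAH: "x \<in> A <#> H" for x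
  proof -
    obtain a h where x: "a \<in> A" "h \<in> H" "x = a \<otimes> h"
      using xAH by (auto simp: set_mult_def)
    have "bij_betw (\<lambda>d. (a \<otimes> d, inv d \<otimes> h)) (A \<inter> H) {u \<in> A \<times> H. fst u \<otimes> snd u = x}"
    proof (rule bij_betwI')
      fix d e assume "d \<in> A \<inter> H" "e \<in> A \<inter> H"
      then show "((a \<otimes> d, inv d \<otimes> h) = (a \<otimes> e, inv e \<otimes> h)) = (d = e)"
        using x by auto
    next
      fix d assume "d \<in> A \<inter> H"
      then have "a \<otimes> d \<otimes> (inv d \<otimes> h) = a \<otimes> (d \<otimes> inv d) \<otimes> h"
        using x by (simp add: m_assoc) (simp add: m_assoc[symmetric])
      then show "(a \<otimes> d, inv d \<otimes> h) \<in> {u \<in> A \<times> H. fst u \<otimes> snd u = x}"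
        using x \<open>d \<in> A \<inter> H\<close> by simp
    next
      fix u assume "u \<in> {u \<in> A \<times> H. fst u \<otimes> snd u = x}"
      then obtain b k where u: "u = (b, k)" "b \<in> A" "k \<in> H" "b \<otimes> k = a \<otimes> h"
        using x by (cases u) auto
      have bk: "inv a \<otimes> b = h \<otimes> inv k"
      proof -
        have "inv a \<otimes> b = inv a \<otimes> (b \<otimes> k) \<otimes> inv k"
          using u(2,3) x(1,2) by (simp add: m_assoc)
        also have "\<dots> = h \<otimes> inv k"
          unfolding u(4) using u(2,3) x by (simp add: m_assoc[symmetric])
        finally show ?thesis .
      qed
      have "inv a \<otimes> b \<in> A \<inter> H"
        using bk u x by (metis A.m_closed A.m_inv_closed H.m_closed H.m_inv_closed IntI)
      moreover have "a \<otimes> (inv a \<otimes> b) = b"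
        using u x by (simp add: m_assoc[symmetric])
      moreover have "inv (inv a \<otimes> b) \<otimes> h = k"
        unfolding bk using u x by (simp add: inv_mult_group m_assoc)
      ultimately show "\<exists>d\<in>A \<inter> H. u = (a \<otimes> d, inv d \<otimes> h)"
        using u by force
    qed
    then show ?thesis
      by (simp add: bij_betw_same_card)
  qed
  have "card A * card H = card (\<Union>x\<in>A <#> H. {u \<in> A \<times> H. fst u \<otimes> snd u = x})"
    unfolding card_cartesian_product[symmetric]
    by (rule arg_cong[where f = card]) (auto simp: set_mult_def)
  also have "\<dots> = (\<Sum>x\<in>A <#> H. card {u \<in> A \<times> H. fst u \<otimes> snd u = x})"
    by (rule card_UN_disjoint) (auto simp: set_mult_def finA finH)
  also have "\<dots> = card (A <#> H) * card (A \<inter> H)"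
    using fibre by simp
  finally show ?thesis by simp
qed

lemma subset_set_mult:
  assumes A: "subgroup A G" and H: "subgroup H G"
  shows "A \<subseteq> A <#> H" "H \<subseteq> A <#> H"
proof -
  have "a = a \<otimes> \<one>" if "a \<in> A" for a
    using subgroup.mem_carrier[OF A that] by simp
  then show "A \<subseteq> A <#> H"
    using subgroup.one_closed[OF H] unfolding set_mult_def by blast
  have "h = \<one> \<otimes> h" if "h \<in> H" for h
    using subgroup.mem_carrier[OF H that] by simp
  then show "H \<subseteq> A <#> H"
    using subgroup.one_closed[OF A] unfolding set_mult_def by blast
qed

lemma subgroup_set_mult_if_permute:
  assumes A: "subgroup A G" and H: "subgroup H G" and AH: "A <#> H = H <#> A"
  shows "subgroup (A <#> H) G"
proof -
  interpret A: subgroup A G by (rule A)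
  interpret H: subgroup H G by (rule H)
  show ?thesis
  proof (rule subgroupI)
    show "A <#> H \<subseteq> carrier G"
      using A.subset H.subset by (rule setmult_subset_G)
    have "\<one> \<otimes> \<one> \<in> A <#> H"
      using A.one_closed H.one_closed unfolding set_mult_def by blast
    then show "A <#> H \<noteq> {}"
      by blast
  next
    fix x assume "x \<in> A <#> H"
    then obtain a h where x: "a \<in> A" "h \<in> H" "x = a \<otimes> h"
      by (auto simp: set_mult_def)
    then have "inv x = inv h \<otimes> inv a"
      by (simp add: inv_mult_group)
    then have "inv x \<in> H <#> A"
      using x unfolding set_mult_def by blast
    then show "inv x \<in> A <#> H"
      by (simp add: AH)
  next
    fix x y assume "x \<in> A <#> H" "y \<in> A <#> H"
    then obtain a h b k where x: "a \<in> A" "h \<in> H" "x = a \<otimes> h" "b \<in> A" "k \<in> H" "y = b \<otimes> k"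
      by (auto simp: set_mult_def)
    have "h \<otimes> b \<in> A <#> H"
      unfolding AH using x by (auto simp: set_mult_def)
    then obtain b' h' where b': "b' \<in> A" "h' \<in> H" "h \<otimes> b = b' \<otimes> h'"
      by (auto simp: set_mult_def)
    have "x \<otimes> y = a \<otimes> (h \<otimes> b) \<otimes> k"
      using x by (simp add: m_assoc)
    also have "\<dots> = (a \<otimes> b') \<otimes> (h' \<otimes> k)"
      unfolding b'(3) using x b'(1,2) by (simp add: m_assoc)
    finally show "x \<otimes> y \<in> A <#> H"
      using x b' unfolding set_mult_def by blast
  qed
qed

text \<open>Applying the inclusion to inverses gives the reverse inclusion.\<close>

lemma set_mult_commute_if_subset:
  assumes K: "subgroup K G" and H: "subgroup H G" and sub: "H <#> K \<subseteq> K <#> H"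
  shows "K <#> H = H <#> K"
proof -
  interpret K: subgroup K G by (rule K)
  interpret H: subgroup H G by (rule H)
  have "k \<otimes> h \<in> H <#> K" if kh: "k \<in> K" "h \<in> H" for k h
  proof -
    have "inv h \<otimes> inv k \<in> H <#> K"
      using K.m_inv_closed[OF kh(1)] H.m_inv_closed[OF kh(2)] unfolding set_mult_def by blast
    then have "inv h \<otimes> inv k \<in> K <#> H"
      using sub by blast
    then obtain k' h' where k': "k' \<in> K" "h' \<in> H" "inv h \<otimes> inv k = k' \<otimes> h'"
      by (auto simp: set_mult_def)
    then have "k \<otimes> h = inv h' \<otimes> inv k'"
      using kh by (metis K.mem_carrier H.mem_carrier inv_mult_group inv_inv m_closed)
    then show ?thesis
      using k' by (auto simp: set_mult_def)
  qed
  then show ?thesis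
    using sub by (auto simp: set_mult_def)
qed

section \<open>Hall subgroups and normal subgroups of a permuting subgroup\<close>

lemma conjugation_iso:
  assumes "h \<in> carrier G"
  shows "(\<lambda>x. h \<otimes> x \<otimes> inv h) \<in> iso G G"
proof (rule isoI)
  show "(\<lambda>x. h \<otimes> x \<otimes> inv h) \<in> hom G G"
  proof (rule homI)
    fix x y assume xy: "x \<in> carrier G" "y \<in> carrier G"
    have "h \<otimes> x \<otimes> inv h \<otimes> (h \<otimes> y \<otimes> inv h) = h \<otimes> x \<otimes> (inv h \<otimes> h) \<otimes> y \<otimes> inv h"
      using xy assms by (simp add: m_assoc) (simp add: m_assoc[symmetric])
    then show "h \<otimes> (x \<otimes> y) \<otimes> inv h = h \<otimes> x \<otimes> inv h \<otimes> (h \<otimes> y \<otimes> inv h)"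
      using xy assms by (simp add: m_assoc)
  qed (use assms in auto)
  show "bij_betw (\<lambda>x. h \<otimes> x \<otimes> inv h) (carrier G) (carrier G)"
  proof (rule bij_betw_byWitness[where f' = "\<lambda>x. inv h \<otimes> x \<otimes> h"])
    show "\<forall>x\<in>carrier G. inv h \<otimes> (h \<otimes> x \<otimes> inv h) \<otimes> h = x"
      using assms by (simp add: m_assoc) (simp add: m_assoc[symmetric])
    show "\<forall>x\<in>carrier G. h \<otimes> (inv h \<otimes> x \<otimes> h) \<otimes> inv h = x"
      using assms by (simp add: m_assoc) (simp add: m_assoc[symmetric])
  qed (use assms in auto)
qed

lemma hall_subgroup_iso_image:
  assumes fin: "finite (carrier G)" and \<phi>: "\<phi> \<in> iso G G" and S: "hall_subgroup \<pi> G S"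
  shows "hall_subgroup \<pi> G (\<phi> ` S)"
proof -
  have sub: "subgroup S G"
    using S by (simp add: hall_subgroup_def)
  interpret \<phi>: group_hom G G \<phi>
    using \<phi> by unfold_locales (auto simp: iso_def)
  have img: "subgroup (\<phi> ` S) G"
    by (rule \<phi>.subgroup_img_is_subgroup[OF sub])
  have card: "card (\<phi> ` S) = card S"
    using \<phi> subgroup.subset[OF sub]
    by (intro card_image) (auto simp: iso_def bij_betw_def intro: inj_on_subset)
  have "card S > 0"
    using fin sub by (simp add: finite_subset subgroup.finite_imp_card_positive)
  then have "card (rcosets (\<phi> ` S)) = card (rcosets S)"
    using lagrange[OF sub] lagrange[OF img] card by (metis mult_right_cancel not_gr_zero)
  then show ?thesis
    using S img card by (simp add: hall_subgroup_def)
qed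

lemma card_subgroup_dvd:
  assumes "subgroup H G" shows "card H dvd order G"
  using lagrange[OF assms] by (metis dvd_triv_right)

text \<open>The number \<open>r\<close> is at once the index of \<open>A \<inter> H\<close> in \<open>A\<close> and the index of \<open>H\<close> in the subgroup
  \<open>A <#> H\<close>. The second description shows that it divides the index of \<open>H\<close> in \<open>G\<close>, so \<open>A \<inter> H\<close>
  is a Hall \<open>\<pi>\<close>-subgroup of \<open>A\<close>.\<close>

lemma card_permuting_product:
  assumes fin: "finite (carrier G)" and A: "subgroup A G"
    and H: "hall_subgroup \<pi> G H" and AH: "A <#> H = H <#> A"
  obtains r where "card A = r * card (A \<inter> H)" "card (A <#> H) = r * card H"
    "prime_divisors_of r \<inter> \<pi> = {}"
proof -
  have subH: "subgroup H G"
    using H by (simp add: hall_subgroup_def)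
  have AiH: "subgroup (A \<inter> H) G"
    using A subH by (rule subgroups_Inter_pair)
  interpret L: group "G\<lparr>carrier := A\<rparr>"
    by (rule subgroup_imp_group[OF A])
  have "card (A \<inter> H) dvd card A"
    using L.card_subgroup_dvd[of "A \<inter> H"] subgroup_incl[OF AiH A] by (simp add: order_def)
  then obtain r where r: "card A = r * card (A \<inter> H)"
    by (metis dvdE mult.commute)
  have pos: "card (A \<inter> H) > 0" "card H > 0"
    using fin AiH subH by (simp_all add: finite_subset subgroup.finite_imp_card_positive)
  have rH: "card (A <#> H) = r * card H"
    using card_set_mult_times_card_Int[OF A subH fin] r pos by simp
  have "card (A <#> H) dvd card (rcosets H) * card H"
    using card_subgroup_dvd[OF subgroup_set_mult_if_permute[OF A subH AH]] lagrange[OF subH] by simp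
  then have "r dvd card (rcosets H)"
    using rH pos by simp
  then have "prime_divisors_of r \<inter> \<pi> = {}"
    using H prime_divisors_of_mono unfolding hall_subgroup_def by blast
  then show thesis
    using that r rH by blast
qed

text \<open>Since \<open>P\<close> is normal in \<open>A\<close>, the product \<open>P <#> (A \<inter> H)\<close> is a \<open>\<pi>\<close>-subgroup of \<open>A\<close> that
  contains the Hall \<open>\<pi>\<close>-subgroup \<open>A \<inter> H\<close>, and so equals it.\<close>

lemma normal_subgroup_le_permuting_hall:
  assumes fin: "finite (carrier G)" and A: "subgroup A G"
    and H: "hall_subgroup \<pi> G H" and AH: "A <#> H = H <#> A"
    and P: "P \<lhd> G\<lparr>carrier := A\<rparr>" and P\<pi>: "prime_divisors_of (card P) \<subseteq> \<pi>"
  shows "P \<subseteq> H"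
proof -
  have subH: "subgroup H G"
    using H by (simp add: hall_subgroup_def)
  have AiH: "subgroup (A \<inter> H) G"
    using A subH by (rule subgroups_Inter_pair)
  interpret L: group "G\<lparr>carrier := A\<rparr>"
    by (rule subgroup_imp_group[OF A])
  have PL: "subgroup P (G\<lparr>carrier := A\<rparr>)"
    using P by (rule normal_imp_subgroup)
  then have PA: "P \<subseteq> A"
    using subgroup.subset by fastforce
  have PG: "subgroup P G"
    using PL A incl_subgroup by blast
  have PiH: "subgroup (P \<inter> H) G"
    using PG subH by (rule subgroups_Inter_pair)
  have finP: "finite P"
    using fin subgroup.subset[OF PG] finite_subset by blast
  obtain r where r: "card A = r * card (A \<inter> H)" "prime_divisors_of r \<inter> \<pi> = {}"
    using card_permuting_product[OF fin A H AH] by blast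
  interpret P: group "G\<lparr>carrier := P\<rparr>"
    by (rule subgroup_imp_group[OF PG])
  have "card (P \<inter> H) dvd card P"
    using P.card_subgroup_dvd[of "P \<inter> H"] subgroup_incl[OF PiH PG] by (simp add: order_def)
  then obtain q where q: "card P = q * card (P \<inter> H)"
    by (metis dvdE mult.commute)
  have pos: "card (A \<inter> H) > 0" "card (P \<inter> H) > 0"
    using fin AiH PiH by (simp_all add: finite_subset subgroup.finite_imp_card_positive)
  have "P \<inter> (A \<inter> H) = P \<inter> H"
    using PA by blast
  then have "card (P <#> (A \<inter> H)) = q * card (A \<inter> H)"
    using card_set_mult_times_card_Int[OF PG AiH fin] q pos by simp
  moreover have "card (P <#> (A \<inter> H)) dvd card A"
    using L.card_subgroup_dvd[OF L.mult_norm_subgroup[OF P subgroup_incl[OF AiH A]]]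
    by (simp add: order_def)
  ultimately have "q dvd r"
    using r(1) pos by simp
  \<comment> \<open>The index \<open>q\<close> of \<open>P \<inter> H\<close> in \<open>P\<close> divides both the \<open>\<pi>\<close>-number \<open>card P\<close> and the number \<open>r\<close>,
    which has no prime divisor in \<open>\<pi>\<close>.\<close>
  then have "prime_divisors_of q \<inter> \<pi> = {}"
    using prime_divisors_of_mono r(2) by blast
  moreover have "prime_divisors_of q \<subseteq> \<pi>"
    using prime_divisors_of_mono[of q "card P"] q P\<pi> by auto
  ultimately have "q = 1"
    using prime_divisors_of_eq_empty_iff by blast
  then have "P \<inter> H = P"
    using q finP by (intro card_subset_eq) auto
  then show ?thesis
    by blast
qed

text \<open>The reason is that \<open>P\<close> is the part inside \<open>A <#> H\<close> of the intersection of all Hall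
  \<open>\<rho>\<close>-subgroups of \<open>G\<close>. That intersection is invariant under conjugation, because conjugates of
  Hall \<open>\<rho>\<close>-subgroups are Hall \<open>\<rho>\<close>-subgroups. It contains \<open>P\<close> because \<open>A\<close> permutes with each of
  them. Finally, \<open>H\<close> contributes nothing to the \<open>\<rho>\<close>-part of the order of \<open>A <#> H\<close>, so this part
  divides \<open>card P\<close>. The existence of \<open>S0\<close> makes the intersection a \<open>\<rho>\<close>-group.\<close>

lemma hall_normalizes_normal_hall:
  assumes fin: "finite (carrier G)" and A: "subgroup A G"
    and disj: "\<pi> \<inter> \<rho> = {}"
    and H: "hall_subgroup \<pi> G H" and AH: "A <#> H = H <#> A"
    and S0: "hall_subgroup \<rho> G S0"
    and perm: "\<And>S. hall_subgroup \<rho> G S \<Longrightarrow> A <#> S = S <#> A"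
    and P: "P \<lhd> G\<lparr>carrier := A\<rparr>" and hallP: "hall_subgroup \<rho> (G\<lparr>carrier := A\<rparr>) P"
    and h: "h \<in> H" and x: "x \<in> P"
  shows "h \<otimes> x \<otimes> inv h \<in> P"
proof -
  define N where "N = (A <#> H) \<inter> \<Inter>{S. hall_subgroup \<rho> G S}"
  have subH: "subgroup H G"
    using H by (simp add: hall_subgroup_def)
  interpret A: subgroup A G by (rule A)
  interpret H: subgroup H G by (rule subH)
  have B: "subgroup (A <#> H) G"
    by (rule subgroup_set_mult_if_permute[OF A subH AH])
  interpret B: subgroup "A <#> H" G by (rule B)
  interpret L: group "G\<lparr>carrier := A\<rparr>"
    by (rule subgroup_imp_group[OF A])
  have PL: "subgroup P (G\<lparr>carrier := A\<rparr>)"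
    using P by (rule normal_imp_subgroup)
  then have PA: "P \<subseteq> A"
    using subgroup.subset by fastforce
  have P\<rho>: "prime_divisors_of (card P) \<subseteq> \<rho>"
    using hallP by (simp add: hall_subgroup_def)
  have "subgroup (\<Inter>(insert (A <#> H) {S. hall_subgroup \<rho> G S})) G"
    by (rule subgroups_Inter) (use B in \<open>auto simp: hall_subgroup_def\<close>)
  then have N: "subgroup N G"
    by (simp add: N_def)
  have PN: "P \<subseteq> N"
    unfolding N_def
    using subset_set_mult(1)[OF A subH] normal_subgroup_le_permuting_hall[OF fin A _ perm P P\<rho>] PA by blast
  have hB: "h \<in> A <#> H"
    using subset_set_mult(2)[OF A subH] h by blast
  have hc: "h \<in> carrier G"
    using h by simp
  have conjN: "h \<otimes> y \<otimes> inv h \<in> N" if y: "y \<in> N" for y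
    unfolding N_def
  proof (intro IntI InterI)
    show "h \<otimes> y \<otimes> inv h \<in> A <#> H"
      using y hB by (simp add: N_def)
    fix S assume "S \<in> {S. hall_subgroup \<rho> G S}"
    then have S: "hall_subgroup \<rho> G S"
      by simp
    then have "hall_subgroup \<rho> G ((\<lambda>x. inv h \<otimes> x \<otimes> inv (inv h)) ` S)"
      by (rule hall_subgroup_iso_image[OF fin conjugation_iso[OF inv_closed[OF hc]]])
    then obtain s where s: "s \<in> S" "y = inv h \<otimes> s \<otimes> h"
      using y hc by (auto simp: N_def)
    have "s \<in> carrier G"
      using S s by (auto simp: hall_subgroup_def dest: subgroup.mem_carrier)
    then have "h \<otimes> y \<otimes> inv h = s"
      unfolding s(2) using hc by (simp add: m_assoc) (simp add: m_assoc[symmetric])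
    then show "h \<otimes> y \<otimes> inv h \<in> S"
      using s by simp
  qed
  have N\<rho>: "prime_divisors_of (card N) \<subseteq> \<rho>"
  proof -
    have sub: "subgroup S0 G"
      using S0 by (simp add: hall_subgroup_def)
    interpret S: group "G\<lparr>carrier := S0\<rparr>"
      by (rule subgroup_imp_group[OF sub])
    have "N \<subseteq> S0"
      using S0 by (auto simp: N_def)
    then have "card N dvd card S0"
      using S.card_subgroup_dvd[of N] subgroup_incl[OF N sub] by (simp add: order_def)
    then show ?thesis
      using S0 prime_divisors_of_mono unfolding hall_subgroup_def by blast
  qed
  obtain r where r: "card A = r * card (A \<inter> H)" "card (A <#> H) = r * card H"
    using card_permuting_product[OF fin A H AH] by blast
  interpret Bg: group "G\<lparr>carrier := A <#> H\<rparr>"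
    by (rule subgroup_imp_group[OF B])
  have "card N dvd card (A <#> H)"
    using Bg.card_subgroup_dvd[of N] subgroup_incl[OF N B] by (simp add: order_def N_def)
  moreover have "coprime (card N) (card H)"
    using N\<rho> H disj by (intro coprime_if_disjoint_prime_divisors) (auto simp: hall_subgroup_def)
  \<comment> \<open>The coprime factor \<open>card H\<close> can be dropped from \<open>card (A <#> H)\<close>, and then, below, the
    coprime factor \<open>card (rcosets P)\<close> from \<open>card A\<close>.\<close>
  ultimately have "card N dvd card A"
    using r by (simp add: coprime_dvd_mult_left_iff)
  then have "card N dvd card (rcosets\<^bsub>G\<lparr>carrier := A\<rparr>\<^esub> P) * card P"
    using L.lagrange[OF PL] by (simp add: order_def)
  moreover have "coprime (card N) (card (rcosets\<^bsub>G\<lparr>carrier := A\<rparr>\<^esub> P))"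
    using N\<rho> hallP by (intro coprime_if_disjoint_prime_divisors) (auto simp: hall_subgroup_def)
  ultimately have dvd: "card N dvd card P"
    by (simp add: coprime_dvd_mult_right_iff)
  have finN: "finite N"
    using fin subgroup.subset[OF N] finite_subset by blast
  have "card P > 0"
    using L.subgroup_imp_group[OF PL] finN PN subgroup.one_closed[OF PL]
    by (metis card_gt_0_iff empty_iff finite_subset)
  then have "P = N"
    using finN PN dvd by (intro card_seteq dvd_imp_le) auto
  then show ?thesis
    using conjN x by simp
qed

section \<open>Automorphisms from direct factors\<close>

text \<open>The extension is the identity on \<open>P\<close>; it is multiplicative because the two normal factors
  centralize each other.\<close>

lemma extend_automorphism_of_direct_factor:
  assumes P: "P \<lhd> G" and C: "C \<lhd> G" and PiC: "P \<inter> C = {\<one>}" and PC: "P <#> C = carrier G"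
    and \<psi>: "\<psi> \<in> iso (G\<lparr>carrier := C\<rparr>) (G\<lparr>carrier := C\<rparr>)"
  obtains \<phi> where "\<phi> \<in> iso G G" "\<And>p c. p \<in> P \<Longrightarrow> c \<in> C \<Longrightarrow> \<phi> (p \<otimes> c) = p \<otimes> \<psi> c"
proof -
  interpret P: normal P G by (rule P)
  interpret C: normal C G by (rule C)
  interpret PC: group_disjoint_sum G P C ..
  have uniq: "p = p' \<and> c = c'"
    if "p \<in> P" "c \<in> C" "p' \<in> P" "c' \<in> C" "p \<otimes> c = p' \<otimes> c'" for p c p' c'
    using PC.cancel PiC that by blast
  have comm: "p \<otimes> c = c \<otimes> p" if "p \<in> P" "c \<in> C" for p c
    using normal_imp_commuting[OF P C _ that] PiC by simp
  have "\<forall>x\<in>carrier G. \<exists>u. fst u \<in> P \<and> snd u \<in> C \<and> x = fst u \<otimes> snd u"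
    unfolding PC[symmetric] set_mult_def by auto
  then obtain u where u: "\<And>x. x \<in> carrier G \<Longrightarrow> fst (u x) \<in> P \<and> snd (u x) \<in> C \<and> x = fst (u x) \<otimes> snd (u x)"
    by metis
  define \<phi> where "\<phi> x = fst (u x) \<otimes> \<psi> (snd (u x))" for x
  have val: "\<phi> (p \<otimes> c) = p \<otimes> \<psi> c" if "p \<in> P" "c \<in> C" for p c
    unfolding \<phi>_def using uniq[OF that, of "fst (u (p \<otimes> c))" "snd (u (p \<otimes> c))"] u[of "p \<otimes> c"] that
    by simp
  have bij: "bij_betw \<psi> C C" and \<psi>m: "\<And>c d. c \<in> C \<Longrightarrow> d \<in> C \<Longrightarrow> \<psi> (c \<otimes> d) = \<psi> c \<otimes> \<psi> d"
    using \<psi> by (auto simp: iso_def hom_def)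
  have \<psi>C: "\<psi> c \<in> C" if "c \<in> C" for c
    using bij that by (auto simp: bij_betw_def)
  have split: "\<exists>p\<in>P. \<exists>c\<in>C. x = p \<otimes> c" if "x \<in> carrier G" for x
    using u[OF that] by blast
  have \<phi>G: "\<phi> x \<in> carrier G" if "x \<in> carrier G" for x
  proof -
    obtain p c where "p \<in> P" "c \<in> C" "x = p \<otimes> c"
      using split[OF \<open>x \<in> carrier G\<close>] by blast
    then show ?thesis
      by (simp add: val \<psi>C)
  qed
  have swap: "p \<otimes> c \<otimes> (q \<otimes> d) = (p \<otimes> q) \<otimes> (c \<otimes> d)"
    if "p \<in> P" "c \<in> C" "q \<in> P" "d \<in> C" for p c q d
  proof -
    have "p \<otimes> c \<otimes> (q \<otimes> d) = p \<otimes> (c \<otimes> q) \<otimes> d"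
      using that by (simp add: m_assoc)
    also have "\<dots> = (p \<otimes> q) \<otimes> (c \<otimes> d)"
      unfolding comm[OF that(3,2), symmetric] using that by (simp add: m_assoc)
    finally show ?thesis .
  qed
  have "\<phi> \<in> iso G G"
  proof (rule isoI)
    show "\<phi> \<in> hom G G"
    proof (rule homI)
      fix x assume "x \<in> carrier G"
      then show "\<phi> x \<in> carrier G"
        by (rule \<phi>G)
    next
      fix x y assume "x \<in> carrier G" "y \<in> carrier G"
      then obtain p c q d where "p \<in> P" "c \<in> C" "x = p \<otimes> c" "q \<in> P" "d \<in> C" "y = q \<otimes> d"
        using split by meson
      note pc = this
      show "\<phi> (x \<otimes> y) = \<phi> x \<otimes> \<phi> y"
        unfolding pc(3,6) val[OF pc(1,2)] val[OF pc(4,5)] swap[OF pc(1,2,4,5)]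
          swap[OF pc(1) \<psi>C[OF pc(2)] pc(4) \<psi>C[OF pc(5)]] \<psi>m[OF pc(2,5), symmetric]
        using pc by (intro val) auto
    qed
    show "bij_betw \<phi> (carrier G) (carrier G)"
      unfolding bij_betw_def
    proof
      show "inj_on \<phi> (carrier G)"
      proof (rule inj_onI)
        fix x y assume "x \<in> carrier G" "y \<in> carrier G" and eq: "\<phi> x = \<phi> y"
        then obtain p c q d where pc: "p \<in> P" "c \<in> C" "x = p \<otimes> c" "q \<in> P" "d \<in> C" "y = q \<otimes> d"
          using split by meson
        then have "p = q \<and> \<psi> c = \<psi> d"
          using eq by (intro uniq) (simp_all add: val \<psi>C)
        then show "x = y"
          using pc bij by (auto simp: bij_betw_def dest: inj_onD)
      qed
      show "\<phi> ` carrier G = carrier G"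
      proof (intro equalityI subsetI)
        fix x assume "x \<in> \<phi> ` carrier G"
        then show "x \<in> carrier G"
          using \<phi>G by blast
      next
        fix x assume "x \<in> carrier G"
        then obtain p c where pc: "p \<in> P" "c \<in> C" "x = p \<otimes> c"
          using split by meson
        then obtain d where "d \<in> C" "c = \<psi> d"
          using bij by (auto simp: bij_betw_def)
        then have "x = \<phi> (p \<otimes> d)"
          using pc val by simp
        then show "x \<in> \<phi> ` carrier G"
          using pc \<open>d \<in> C\<close> by auto
      qed
    qed
  qed
  then show thesis
    using that val by blast
qed

text \<open>Conjugation by \<open>h\<close> in \<open>H\<close> need not map \<open>A\<close> to itself, since \<open>P\<close> may be moved out of \<open>A\<close>.
  Replacing it by the identity on \<open>P\<close> produces an automorphism of \<open>A\<close>, which preserves \<open>K\<close>; the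
  error made is absorbed by \<open>P \<subseteq> H\<close>.\<close>

lemma characteristic_subgroup_permutes:
  assumes fin: "finite (carrier G)" and A: "subgroup A G" and H: "subgroup H G"
    and P: "P \<lhd> G\<lparr>carrier := A\<rparr>" and C: "C \<lhd> G\<lparr>carrier := A\<rparr>"
    and PiC: "P \<inter> C = {\<one>}" and PC: "P <#> C = A" and PH: "P \<subseteq> H"
    and norm: "\<And>h c. h \<in> H \<Longrightarrow> c \<in> C \<Longrightarrow> h \<otimes> c \<otimes> inv h \<in> C"
    and K: "characteristic_subgroup K (G\<lparr>carrier := A\<rparr>)"
  shows "K <#> H = H <#> K"
proof -
  interpret A: subgroup A G by (rule A)
  interpret H: subgroup H G by (rule H)
  interpret L: group "G\<lparr>carrier := A\<rparr>"
    by (rule subgroup_imp_group[OF A])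
  have KG: "subgroup K G"
    using K incl_subgroup[OF A] by (simp add: characteristic_subgroup_def)
  have CG: "subgroup C G"
    using C incl_subgroup[OF A] normal_imp_subgroup by blast
  have KA: "K \<subseteq> A"
    using K subgroup.subset[of K "G\<lparr>carrier := A\<rparr>"] by (simp add: characteristic_subgroup_def)
  interpret C: subgroup C G by (rule CG)
  interpret K: subgroup K G by (rule KG)
  have PG: "subgroup P G"
    using P incl_subgroup[OF A] normal_imp_subgroup by blast
  interpret P: subgroup P G by (rule PG)
  have comm: "p \<otimes> c = c \<otimes> p" if "p \<in> P" "c \<in> C" for p c
    using L.normal_imp_commuting[OF P C _ that] PiC by simp
  have "h \<otimes> k \<in> K <#> H" if h: "h \<in> H" and k: "k \<in> K" for h k
  proof -
    let ?\<psi> = "\<lambda>c. h \<otimes> c \<otimes> inv h"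
    have hc: "h \<in> carrier G"
      using h by simp
    have "?\<psi> \<in> iso (G\<lparr>carrier := C\<rparr>) (G\<lparr>carrier := C\<rparr>)"
    proof (rule isoI)
      have "?\<psi> (c \<otimes> d) = ?\<psi> c \<otimes> ?\<psi> d" if "c \<in> C" "d \<in> C" for c d
        using conjugation_iso[OF hc] that by (auto simp: iso_def hom_def)
      then show "?\<psi> \<in> hom (G\<lparr>carrier := C\<rparr>) (G\<lparr>carrier := C\<rparr>)"
        using norm[OF h] by (auto simp: hom_def)
      have "inj_on ?\<psi> C"
        using conjugation_iso[OF hc] C.subset
        by (auto simp: iso_def bij_betw_def intro: inj_on_subset)
      moreover have "?\<psi> ` C = C"
        using calculation norm[OF h] fin C.subset
        by (intro endo_inj_surj) (auto intro: finite_subset)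
      ultimately show "bij_betw ?\<psi> (carrier (G\<lparr>carrier := C\<rparr>)) (carrier (G\<lparr>carrier := C\<rparr>))"
        by (simp add: bij_betw_def)
    qed
    then obtain \<phi> where \<phi>: "\<phi> \<in> iso (G\<lparr>carrier := A\<rparr>) (G\<lparr>carrier := A\<rparr>)"
      and val: "\<And>p c. p \<in> P \<Longrightarrow> c \<in> C \<Longrightarrow> \<phi> (p \<otimes> c) = p \<otimes> ?\<psi> c"
      using L.extend_automorphism_of_direct_factor[OF P C] PiC PC by auto
    obtain p c where pc: "p \<in> P" "c \<in> C" "k = p \<otimes> c"
      using k KA PC unfolding set_mult_def by blast
    have \<phi>K: "\<phi> k \<in> K"
      using K \<phi> k by (auto simp: characteristic_subgroup_def)
    have mem: "p \<in> carrier G" "c \<in> carrier G" "h \<otimes> c \<otimes> inv h \<in> carrier G"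
      using pc hc by auto
    \<comment> \<open>Since \<open>k = c \<otimes> p\<close>, moving \<open>h\<close> past \<open>c\<close> produces \<open>h \<otimes> c \<otimes> inv h\<close>,
      which is \<open>\<phi> k\<close> up to the element \<open>p\<close> of \<open>H\<close>.\<close>
    have "h \<otimes> k = h \<otimes> c \<otimes> inv h \<otimes> (h \<otimes> p)"
      unfolding pc(3) comm[OF pc(1,2)] using mem hc
      by (simp add: m_assoc) (simp add: m_assoc[symmetric])
    also have "h \<otimes> c \<otimes> inv h = \<phi> k \<otimes> inv p"
    proof -
      have "\<phi> k = (h \<otimes> c \<otimes> inv h) \<otimes> p"
        using val[OF pc(1,2)] comm[OF pc(1) norm[OF h pc(2)]] pc(3) by simp
      then show ?thesis
        using mem by (simp add: m_assoc del: m_assoc) (simp add: m_assoc mem)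
    qed
    also have "\<phi> k \<otimes> inv p \<otimes> (h \<otimes> p) = \<phi> k \<otimes> (inv p \<otimes> (h \<otimes> p))"
      using \<phi>K mem hc by (simp add: m_assoc)
    finally have "h \<otimes> k = \<phi> k \<otimes> (inv p \<otimes> (h \<otimes> p))" .
    moreover have "inv p \<otimes> (h \<otimes> p) \<in> H"
      using pc PH h by blast
    ultimately show ?thesis
      using \<phi>K unfolding set_mult_def by blast
  qed
  then have "H <#> K \<subseteq> K <#> H"
    by (auto simp: set_mult_def[of _ H])
  then show ?thesis
    by (rule set_mult_commute_if_subset[OF KG H])
qed

end

section \<open>Permutability of characteristic subgroups\<close>

text \<open>A direct decomposition into Hall subgroups is regrouped as the \<open>\<sigma> i\<close>-part times all the rest.
  The family \<open>\<D>\<close> of remaining factors is kept, as each of them is handled separately by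
  \<open>hall_normalizes_normal_hall\<close>. A complete Hall set may contain the trivial subgroup, hence
  the condition \<open>M \<noteq> {\<one>}\<close>.\<close>

lemma (in group) sigma_nilpotent_splits:
  assumes fin: "finite (carrier G)"
    and nil: "sigma_nilpotent \<sigma> I G" and i: "i \<in> I"
  obtains P \<D> where "P \<lhd> G" "prime_divisors_of (card P) \<subseteq> \<sigma> i"
    "\<And>M. M \<in> \<D> \<Longrightarrow> M \<lhd> G"
    "\<And>M. M \<in> \<D> \<Longrightarrow> M \<noteq> {\<one>} \<Longrightarrow> \<exists>j\<in>I. j \<noteq> i \<and> hall_subgroup (\<sigma> j) G M"
    "generate G (\<Union>\<D>) \<lhd> G" "P \<inter> generate G (\<Union>\<D>) = {\<one>}" "P <#> generate G (\<Union>\<D>) = carrier G"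
proof -
  obtain \<H> where \<H>: "complete_hall_set \<sigma> I G \<H>" and dp: "internal_direct_product G \<H>"
    using nil by (auto simp: sigma_nilpotent_def)
  have normal: "M \<lhd> G" if "M \<in> \<H>" for M
    using dp that by (simp add: internal_direct_product_def)
  have gen: "generate G (\<Union>\<H>) = carrier G"
    using dp by (simp add: internal_direct_product_def)
  have subc: "\<Union>\<D> \<subseteq> carrier G" if "\<D> \<subseteq> \<H>" for \<D>
    using that normal normal_imp_subgroup subgroup.subset by blast
  have gen_normal: "generate G (\<Union>\<D>) \<lhd> G" if "\<D> \<subseteq> \<H>" for \<D>
    using subc[OF that]
  proof (rule normal_generateI)
    fix h g assume "h \<in> \<Union>\<D>" "g \<in> carrier G"
    then show "g \<otimes> h \<otimes> inv g \<in> \<Union>\<D>"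
      using that normal normal_invE(2) by blast
  qed
  have hall: "\<exists>j\<in>I. hall_subgroup (\<sigma> j) G M" if "M \<in> \<H>" "M \<noteq> {\<one>}" for M
    using \<H> that by (auto simp: complete_hall_set_def)
  show thesis
  proof (cases "\<sigma> i \<inter> prime_divisors_of (order G) = {}")
    case True
    \<comment> \<open>Then \<open>\<H>\<close> need not contain a Hall \<open>\<sigma> i\<close>-subgroup; the trivial subgroup serves as one.\<close>
    show thesis
    proof (rule that[of "{\<one>}" \<H>])
      show "\<exists>j\<in>I. j \<noteq> i \<and> hall_subgroup (\<sigma> j) G M" if M: "M \<in> \<H>" "M \<noteq> {\<one>}" for M
      proof -
        have "\<not> hall_subgroup (\<sigma> i) G M"
        proof
          assume hM: "hall_subgroup (\<sigma> i) G M"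
          then have "prime_divisors_of (card M) \<subseteq> prime_divisors_of (order G)"
            by (intro prime_divisors_of_mono card_subgroup_dvd) (simp add: hall_subgroup_def)
          moreover have "prime_divisors_of (card M) \<subseteq> \<sigma> i"
            using hM by (simp add: hall_subgroup_def)
          ultimately have "prime_divisors_of (card M) = {}"
            using True by blast
          then have "card M = 1"
            by (simp add: prime_divisors_of_eq_empty_iff)
          moreover have "\<one> \<in> M"
            using hM by (simp add: hall_subgroup_def subgroup.one_closed)
          ultimately show False
            using M(2) by (metis card_1_singletonE singletonD)
        qed
        then show ?thesis
          using hall[OF M] by metis
      qed
      show "{\<one>} <#> generate G (\<Union>\<H>) = carrier G"
        unfolding gen by (auto simp: set_mult_def)
    qed (use normal one_is_normal gen gen_normal[of \<H>] in \<open>auto simp: prime_divisors_of_def\<close>)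
  next
    case False
    then obtain P where P: "P \<in> \<H>" "hall_subgroup (\<sigma> i) G P"
      and uniq: "\<And>M. M \<in> \<H> \<Longrightarrow> hall_subgroup (\<sigma> i) G M \<Longrightarrow> M = P"
      using \<H> i unfolding complete_hall_set_def by metis
    let ?C = "generate G (\<Union>(\<H> - {P}))"
    have C: "?C \<lhd> G"
      by (rule gen_normal) blast
    show thesis
    proof (rule that[of P "\<H> - {P}"])
      show "P <#> ?C = carrier G"
      proof
        have PC: "subgroup (P <#> ?C) G"
          using mult_norm_subgroup normal[OF P(1)] normal_imp_subgroup[OF C] by blast
        then show "P <#> ?C \<subseteq> carrier G"
          by (rule subgroup.subset)
        have "P \<subseteq> P <#> ?C" "?C \<subseteq> P <#> ?C"
          using subset_set_mult normal[OF P(1)] C normal_imp_subgroup by blast+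
        moreover have "\<Union>\<H> \<subseteq> P \<union> ?C"
          by (auto intro: generate.incl)
        ultimately have "\<Union>\<H> \<subseteq> P <#> ?C"
          by blast
        then show "carrier G \<subseteq> P <#> ?C"
          using generate_subgroup_incl[OF _ PC] gen by blast
      qed
      show "P \<inter> ?C = {\<one>}"
        using dp P(1) by (simp add: internal_direct_product_def)
      show "\<exists>j\<in>I. j \<noteq> i \<and> hall_subgroup (\<sigma> j) G M" if "M \<in> \<H> - {P}" "M \<noteq> {\<one>}" for M
        using that hall[of M] uniq[of M] by (metis DiffE singletonI)
    qed (use P normal C in \<open>auto simp: hall_subgroup_def\<close>)
  qed
qed

lemma (in group) generate_conjugation_closed:
  assumes h: "h \<in> carrier G" and X: "X \<subseteq> carrier G"
    and closed: "\<And>x. x \<in> X \<Longrightarrow> h \<otimes> x \<otimes> inv h \<in> generate G X"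
    and c: "c \<in> generate G X"
  shows "h \<otimes> c \<otimes> inv h \<in> generate G X"
proof -
  interpret \<phi>: group_hom G G "\<lambda>x. h \<otimes> x \<otimes> inv h"
    using conjugation_iso[OF h] by unfold_locales (auto simp: iso_def)
  have "(\<lambda>x. h \<otimes> x \<otimes> inv h) ` generate G X = generate G ((\<lambda>x. h \<otimes> x \<otimes> inv h) ` X)"
    by (rule \<phi>.generate_img[OF X, symmetric])
  also have "\<dots> \<subseteq> generate G X"
    using closed by (intro generate_subgroup_incl generate_is_subgroup X) auto
  finally show ?thesis
    using c by blast
qed

lemma (in group) sigma_permutable_characteristic_subgroup:
  assumes disj: "disjoint_family_on \<sigma> I" and fin: "finite (carrier G)"
    and nil: "sigma_nilpotent \<sigma> I (G\<lparr>carrier := A\<rparr>)"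
    and perm: "sigma_permutable \<sigma> I G A"
    and K: "characteristic_subgroup K (G\<lparr>carrier := A\<rparr>)"
  shows "sigma_permutable \<sigma> I G K"
  unfolding sigma_permutable_def
proof (intro conjI ballI allI impI)
  have A: "subgroup A G" and full: "sigma_full \<sigma> I G"
    and AH: "\<And>i H. i \<in> I \<Longrightarrow> hall_subgroup (\<sigma> i) G H \<Longrightarrow> A <#> H = H <#> A"
    using perm by (auto simp: sigma_permutable_def)
  interpret A: subgroup A G by (rule A)
  interpret L: group "G\<lparr>carrier := A\<rparr>"
    by (rule subgroup_imp_group[OF A])
  show "subgroup K G"
    using K incl_subgroup[OF A] by (simp add: characteristic_subgroup_def)
  show "sigma_full \<sigma> I G"
    by (rule full)
  fix i H assume i: "i \<in> I" and H: "hall_subgroup (\<sigma> i) G H"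
  have subH: "subgroup H G"
    using H by (simp add: hall_subgroup_def)
  have finA: "finite A"
    using fin A.subset finite_subset by blast
  obtain P \<D> where P: "P \<lhd> G\<lparr>carrier := A\<rparr>" "prime_divisors_of (card P) \<subseteq> \<sigma> i"
    and \<D>: "\<And>M. M \<in> \<D> \<Longrightarrow> M \<lhd> G\<lparr>carrier := A\<rparr>"
    and hall: "\<And>M. M \<in> \<D> \<Longrightarrow> M \<noteq> {\<one>} \<Longrightarrow> \<exists>j\<in>I. j \<noteq> i \<and> hall_subgroup (\<sigma> j) (G\<lparr>carrier := A\<rparr>) M"
    and C: "generate (G\<lparr>carrier := A\<rparr>) (\<Union>\<D>) \<lhd> G\<lparr>carrier := A\<rparr>"
      "P \<inter> generate (G\<lparr>carrier := A\<rparr>) (\<Union>\<D>) = {\<one>}"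
      "P <#> generate (G\<lparr>carrier := A\<rparr>) (\<Union>\<D>) = A"
    using L.sigma_nilpotent_splits[OF _ nil i] finA by auto
  have \<D>A: "\<Union>\<D> \<subseteq> A"
    using \<D> normal_imp_subgroup subgroup.subset by fastforce
  have gen: "generate (G\<lparr>carrier := A\<rparr>) (\<Union>\<D>) = generate G (\<Union>\<D>)"
    by (rule generate_consistent[OF \<D>A A])
  have conj: "h \<otimes> x \<otimes> inv h \<in> M" if M: "M \<in> \<D>" "x \<in> M" and h: "h \<in> H" for h x M
  proof (cases "M = {\<one>}")
    case True
    then show ?thesis
      using M subgroup.mem_carrier[OF subH h] by simp
  next
    case False
    then obtain j where j: "j \<in> I" "j \<noteq> i" "hall_subgroup (\<sigma> j) (G\<lparr>carrier := A\<rparr>) M"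
      using hall M by blast
    \<comment> \<open>As \<open>M\<close> is nontrivial, \<open>\<sigma> j\<close> contains a prime divisor of the order of \<open>G\<close>, so a
      complete Hall set of \<open>G\<close> has a Hall \<open>\<sigma> j\<close>-subgroup among its members.\<close>
    have "prime_divisors_of (card M) \<noteq> {}"
    proof
      assume "prime_divisors_of (card M) = {}"
      then have "card M = 1"
        by (simp add: prime_divisors_of_eq_empty_iff)
      moreover have "\<one> \<in> M"
        using \<D>[OF M(1)] normal_imp_subgroup subgroup.one_closed by fastforce
      ultimately show False
        using False by (metis card_1_singletonE singletonD)
    qed
    moreover have "prime_divisors_of (card M) \<subseteq> prime_divisors_of (order G)"
      using incl_subgroup[OF A normal_imp_subgroup[OF \<D>[OF M(1)]]]
      by (intro prime_divisors_of_mono card_subgroup_dvd)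
    moreover have "prime_divisors_of (card M) \<subseteq> \<sigma> j"
      using j by (simp add: hall_subgroup_def)
    ultimately have "\<sigma> j \<inter> prime_divisors_of (order G) \<noteq> {}"
      by blast
    moreover obtain \<H> where "complete_hall_set \<sigma> I G \<H>"
      using full by (auto simp: sigma_full_def)
    ultimately obtain S where S: "hall_subgroup (\<sigma> j) G S"
      using j(1) unfolding complete_hall_set_def by metis
    have "\<sigma> i \<inter> \<sigma> j = {}"
      using disj i j by (auto simp: disjoint_family_on_def)
    then show ?thesis
      using hall_normalizes_normal_hall[OF fin A _ H AH[OF i H] S AH[OF j(1)] \<D>[OF M(1)] j(3) h M(2)]
      by simp
  qed
  show "K <#> H = H <#> K"
  proof (rule characteristic_subgroup_permutes[OF fin A subH P(1) C _ _ K])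
    show "P \<subseteq> H"
      by (rule normal_subgroup_le_permuting_hall[OF fin A H AH[OF i H] P])
    fix h c assume h: "h \<in> H" and c: "c \<in> generate (G\<lparr>carrier := A\<rparr>) (\<Union>\<D>)"
    show "h \<otimes> c \<otimes> inv h \<in> generate (G\<lparr>carrier := A\<rparr>) (\<Union>\<D>)"
      using c unfolding gen
    proof (rule generate_conjugation_closed[rotated -1])
      show "h \<in> carrier G"
        by (rule subgroup.mem_carrier[OF subH h])
      show "\<Union>\<D> \<subseteq> carrier G"
        using \<D>A A.subset by blast
      show "h \<otimes> x \<otimes> inv h \<in> generate G (\<Union>\<D>)" if "x \<in> \<Union>\<D>" for x
        using that conj h by (intro generate.incl) blast
    qed
  qed
qed

lemma (in group) characteristic_subgroup_self: "characteristic_subgroup (carrier G) G"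
  by (auto simp: characteristic_subgroup_def subgroup_self iso_def bij_betw_def)

theorem theoremC:
  fixes \<sigma> :: "'i \<Rightarrow> nat set" and I :: "'i set"
    and G :: "('a, 'b) monoid_scheme" and A :: "'a set"
  assumes "prime_partition \<sigma> I"
    and "group G" and "finite (carrier G)"
    and "subgroup A G"
    and "sigma_nilpotent \<sigma> I (G\<lparr>carrier := A\<rparr>)"
  shows "sigma_permutable \<sigma> I G A \<longleftrightarrow>
    (\<forall>K. characteristic_subgroup K (G\<lparr>carrier := A\<rparr>) \<longrightarrow> sigma_permutable \<sigma> I G K)"
proof
  assume "sigma_permutable \<sigma> I G A"
  then show "\<forall>K. characteristic_subgroup K (G\<lparr>carrier := A\<rparr>) \<longrightarrow> sigma_permutable \<sigma> I G K"
    using group.sigma_permutable_characteristic_subgroup assms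
    by (metis prime_partition_def)
next
  assume "\<forall>K. characteristic_subgroup K (G\<lparr>carrier := A\<rparr>) \<longrightarrow> sigma_permutable \<sigma> I G K"
  moreover have "characteristic_subgroup A (G\<lparr>carrier := A\<rparr>)"
    using group.characteristic_subgroup_self[OF group.subgroup_imp_group] assms by fastforce
  ultimately show "sigma_permutable \<sigma> I G A"
    by blast
qed

end
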